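(* Let $\mathbf{k}$ be a field of characteristic $0$. Every multiplicative right Hom-alternative algebra over $\mathbf{k}$ and every multiplicative non-commutative Hom-Jordan algebra over $\mathbf{k}$ is Hom-power associative.
   Context: A Hom-algebra $(A,\mu,\alpha)$ over $\mathbf{k}$ is a $\mathbf{k}$-vector space $A$ with a bilinear map $\mu\colon A^{\otimes 2}\to A$ (no associativity assumed; write $xy=\mu(x,y)$) and a linear map $\alpha\colon A\to A$. It is multiplicative if $\alpha(xy)=\alpha(x)\alpha(y)$ for all $x,y$. Here $\alpha^n$ is the $n$-fold composition, $\alpha^0=Id$. Hom-powers: $x^1=x$ and $x^n=x^{n-1}\alpha^{n-2}(x)$ for $n\ge 2$. $A$ is $n$th Hom-power associative if $x^n=\alpha^{n-i-1}(x^i)\,\alpha^{i-1}(x^{n-i})$ for all $x\in A$ and $i\in\{1,\dots,n-1\}$, and Hom-power associative if this holds for all $n\ge 2$. The Hom-associator is $as_A(x,y,z)=(xy)\alpha(z)-\alpha(x)(yz)$. $A$ is right Hom-alternative if $as_A(y,x,x)=0$ for all $x,y\in A$. $A$ is a non-commutative Hom-Jordan algebra if $as_A(x,y,x)=0$ (Hom-flexibility) and $as_A(x^2,\alpha(y),\alpha(x))=0$ for all $x,y\in A$, where $x^2=xx$. *)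

theory Defs
  imports Complex_Main
begin

locale hom_algebra = vector_space scale
  for scale :: "'k::field \<Rightarrow> 'a::ab_group_add \<Rightarrow> 'a" +
  fixes mu :: "'a \<Rightarrow> 'a \<Rightarrow> 'a"
    and \<alpha> :: "'a \<Rightarrow> 'a"
  assumes mu_linear_right: "\<And>x. Vector_Spaces.linear scale scale (\<lambda>y. mu x y)"
    and mu_linear_left: "\<And>y. Vector_Spaces.linear scale scale (\<lambda>x. mu x y)"
    and alpha_linear: "Vector_Spaces.linear scale scale \<alpha>"

definition multiplicative :: "('a \<Rightarrow> 'a \<Rightarrow> 'a) \<Rightarrow> ('a \<Rightarrow> 'a) \<Rightarrow> bool" where
  "multiplicative mu \<alpha> \<longleftrightarrow> (\<forall>x y. \<alpha> (mu x y) = mu (\<alpha> x) (\<alpha> y))"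

(* Only exponents n \<ge> 1 are meaningful; the value at 0 is a placeholder, as A need not have a unit. *)
fun hom_power :: "('a \<Rightarrow> 'a \<Rightarrow> 'a) \<Rightarrow> ('a \<Rightarrow> 'a) \<Rightarrow> 'a \<Rightarrow> nat \<Rightarrow> 'a" where
  "hom_power mu \<alpha> x 0 = undefined"
| "hom_power mu \<alpha> x (Suc 0) = x"
| "hom_power mu \<alpha> x (Suc (Suc n)) = mu (hom_power mu \<alpha> x (Suc n)) ((\<alpha> ^^ n) x)"

definition nth_hom_power_associative ::
    "('a \<Rightarrow> 'a \<Rightarrow> 'a) \<Rightarrow> ('a \<Rightarrow> 'a) \<Rightarrow> nat \<Rightarrow> bool" where
  "nth_hom_power_associative mu \<alpha> n \<longleftrightarrow>
     (\<forall>x. \<forall>i\<in>{1..n - 1}.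
        hom_power mu \<alpha> x n =
          mu ((\<alpha> ^^ (n - i - 1)) (hom_power mu \<alpha> x i))
             ((\<alpha> ^^ (i - 1)) (hom_power mu \<alpha> x (n - i))))"

definition hom_power_associative :: "('a \<Rightarrow> 'a \<Rightarrow> 'a) \<Rightarrow> ('a \<Rightarrow> 'a) \<Rightarrow> bool" where
  "hom_power_associative mu \<alpha> \<longleftrightarrow> (\<forall>n\<ge>2. nth_hom_power_associative mu \<alpha> n)"

definition hom_associator ::
    "('a::ab_group_add \<Rightarrow> 'a \<Rightarrow> 'a) \<Rightarrow> ('a \<Rightarrow> 'a) \<Rightarrow> 'a \<Rightarrow> 'a \<Rightarrow> 'a \<Rightarrow> 'a" where
  "hom_associator mu \<alpha> x y z = mu (mu x y) (\<alpha> z) - mu (\<alpha> x) (mu y z)"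

definition right_hom_alternative ::
    "('a::ab_group_add \<Rightarrow> 'a \<Rightarrow> 'a) \<Rightarrow> ('a \<Rightarrow> 'a) \<Rightarrow> bool" where
  "right_hom_alternative mu \<alpha> \<longleftrightarrow> (\<forall>x y. hom_associator mu \<alpha> y x x = 0)"

definition hom_flexible ::
    "('a::ab_group_add \<Rightarrow> 'a \<Rightarrow> 'a) \<Rightarrow> ('a \<Rightarrow> 'a) \<Rightarrow> bool" where
  "hom_flexible mu \<alpha> \<longleftrightarrow> (\<forall>x y. hom_associator mu \<alpha> x y x = 0)"

definition noncommutative_hom_jordan ::
    "('a::ab_group_add \<Rightarrow> 'a \<Rightarrow> 'a) \<Rightarrow> ('a \<Rightarrow> 'a) \<Rightarrow> bool" where
  "noncommutative_hom_jordan mu \<alpha> \<longleftrightarrow>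
     hom_flexible mu \<alpha> \<and>
     (\<forall>x y. hom_associator mu \<alpha> (mu x x) (\<alpha> y) (\<alpha> x) = 0)"

end

theory Submission
  imports Defs
begin

text \<open>
  Two identities in one variable, the cubic one \<open>(xx)\<alpha>(x) = \<alpha>(x)(xx)\<close> and the quartic one
  \<open>((xx)\<alpha>(x))\<alpha>\<^sup>2(x) = \<alpha>(xx)\<alpha>(xx)\<close>, already force Hom-power associativity in
  characteristic zero, just as Albert's theorem says for ordinary algebras. Both classes in the
  theorem satisfy them: Hom-flexibility or right Hom-alternativity at \<open>y = x\<close> is the cubic
  identity, and the vanishing of \<open>as(xx, \<alpha>(x), \<alpha>(x))\<close> is the quartic one.

  To derive \<open>n\<close>-th Hom-power associativity from the lower ones, fix \<open>x\<close> and let \<open>f i\<close> be the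
  product of the suitably twisted Hom-powers \<open>x\<^sup>i\<close> and \<open>x\<^sup>n\<^sup>-\<^sup>i\<close>. What is needed is that \<open>f\<close> is
  constant. Polarizing the two identities and inserting \<open>\<alpha>\<close>-twists of powers whose exponents
  add up to \<open>n\<close> turns every product of fewer than all the factors into a twisted power by the
  induction hypothesis. The twists can be chosen so that the exponents of \<open>\<alpha>\<close> always match
  (\<open>split_product_cubic_relation\<close>, \<open>split_product_quartic_relation\<close>), and
  two families of linear relations between the values of \<open>f\<close> remain.

  These are solved by elementary linear algebra. The cubic relations say that
  \<open>f (n - i) - f i\<close> is additive in \<open>i\<close>; being also odd under \<open>i \<mapsto> n - i\<close>, it is killed by
  \<open>n\<close>, so it vanishes (\<open>antisymmetric_part_zero\<close>). The quartic relations with two exponents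
  equal to one then form a second-order recurrence expressing \<open>f i - f 1\<close> as a rational multiple
  of \<open>f 2 - f 1\<close>. These multiples are strictly increasing, while \<open>f (n - 1) - f 1 = 0\<close> by
  symmetry, so \<open>f 2 = f 1\<close> and \<open>f\<close> is constant (\<open>symmetric_relations_constant\<close>).
\<close>

section \<open>Polarization\<close>

text \<open>
  By inclusion-exclusion over the subsets of \<open>{a, b, c}\<close>, the terms in which every argument occurs
  exactly once are a signed sum of values on the diagonal. No division is involved, so this holds
  in any abelian group.
\<close>

lemma polarize_trilinear:
  fixes T :: "'a::ab_group_add \<Rightarrow> 'a \<Rightarrow> 'a \<Rightarrow> 'a"
  assumes add: "\<And>u v b c. T (u + v) b c = T u b c + T v b c"
    "\<And>a u v c. T a (u + v) c = T a u c + T a v c"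
    "\<And>a b u v. T a b (u + v) = T a b u + T a b v"
    and diag: "\<And>u. T u u u = 0"
  shows "T a b c + T a c b + T b a c + T b c a + T c a b + T c b a = 0"
proof -
  let ?Q = "\<lambda>u. T u u u"
  have "T a b c + T a c b + T b a c + T b c a + T c a b + T c b a =
      ?Q (a + b + c) - ?Q (a + b) - ?Q (a + c) - ?Q (b + c) + ?Q a + ?Q b + ?Q c"
    by (simp only: add) (simp add: algebra_simps)
  then show ?thesis by (simp add: diag)
qed

lemma polarize_quadrilinear:
  fixes T :: "'a::ab_group_add \<Rightarrow> 'a \<Rightarrow> 'a \<Rightarrow> 'a \<Rightarrow> 'a"
  assumes add: "\<And>u v b c d. T (u + v) b c d = T u b c d + T v b c d"
    "\<And>a u v c d. T a (u + v) c d = T a u c d + T a v c d"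
    "\<And>a b u v d. T a b (u + v) d = T a b u d + T a b v d"
    "\<And>a b c u v. T a b c (u + v) = T a b c u + T a b c v"
    and diag: "\<And>u. T u u u u = 0"
  shows "(T a b c d + T a c b d + T b a c d + T b c a d + T c a b d + T c b a d) +
    (T a b d c + T a d b c + T b a d c + T b d a c + T d a b c + T d b a c) +
    (T a c d b + T a d c b + T c a d b + T c d a b + T d a c b + T d c a b) +
    (T b c d a + T b d c a + T c b d a + T c d b a + T d b c a + T d c b a) = 0" (is "?S = 0")
proof -
  let ?Q = "\<lambda>u. T u u u u"
  have "?S = ?Q (a + b + c + d)
      - ?Q (a + b + c) - ?Q (a + b + d) - ?Q (a + c + d) - ?Q (b + c + d)
      + ?Q (a + b) + ?Q (a + c) + ?Q (a + d) + ?Q (b + c) + ?Q (b + d) + ?Q (c + d)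
      - ?Q a - ?Q b - ?Q c - ?Q d"
    by (simp only: add) (simp add: algebra_simps)
  then show ?thesis by (simp add: diag)
qed

section \<open>Solving the relations between split products\<close>

text \<open>
  The multiples in \<open>f (k + 1) - f 1 = growth k \<cdot> (f 2 - f 1)\<close> for a symmetric \<open>f\<close> that satisfies
  the quartic relations. They are rational rather than scalars because the argument needs
  their order.
\<close>

fun growth :: "nat \<Rightarrow> rat" where
  "growth 0 = 0"
| "growth (Suc 0) = 1"
| "growth (Suc (Suc k)) = 8/3 * growth (Suc k) - growth k + 4/3"

lemma growth_step: "0 \<le> growth k \<and> growth k + 1 \<le> growth (Suc k)"
  by (induction k) auto

lemma growth_pos: "0 < k \<Longrightarrow> 0 < growth k"
  using growth_step[of "k - 1"] by (cases k) auto

locale vector_space_char_0 = vector_space scale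
  for scale :: "'k::field_char_0 \<Rightarrow> 'a::ab_group_add \<Rightarrow> 'a"
begin

lemma scale_numeral_unfold:
  fixes v :: 'a
  shows "scale 2 v = v + v"
  "scale 3 v = v + v + v"
  "scale 4 v = v + v + v + v"
  "scale 6 v = v + v + v + v + v + v"
  "scale 8 v = v + v + v + v + v + v + v + v"
proof -
  have *: "scale (c + 1) v = scale c v + v" for c
    by (simp add: scale_left_distrib)
  show 2: "scale 2 v = v + v" using *[of 1] by simp
  show 3: "scale 3 v = v + v + v" using *[of 2] 2 by simp
  show 4: "scale 4 v = v + v + v + v" using *[of 3] 3 by simp
  show 6: "scale 6 v = v + v + v + v + v + v" using *[of 4] *[of 5] 4 by simp
  show 8: "scale 8 v = v + v + v + v + v + v + v + v" using *[of 6] *[of 7] 6 by simp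
qed

lemma double_eq_0: "v + v = 0 \<Longrightarrow> v = 0" for v :: 'a
  using scale_numeral_unfold(1)[of v] by simp

text \<open>
  With \<open>g i = f (n - i) - f i\<close> the relations say \<open>g a + g b + g c = 0\<close> whenever \<open>a + b + c = n\<close>.
  As \<open>g (n - c) = - g c\<close>, this is additivity, so \<open>g i = i \<cdot> g 1\<close>, and comparing \<open>g (n - 1) = - g 1\<close>
  with \<open>(n - 1) \<cdot> g 1\<close> gives \<open>n \<cdot> g 1 = 0\<close>.
\<close>

lemma antisymmetric_part_zero:
  fixes f :: "nat \<Rightarrow> 'a"
  assumes rel: "\<And>a b c. a \<ge> 1 \<Longrightarrow> b \<ge> 1 \<Longrightarrow> c \<ge> 1 \<Longrightarrow> a + b + c = n \<Longrightarrow>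
      f (n - a) + f (n - b) + f (n - c) = f a + f b + f c"
    and i: "1 \<le> i" "i < n"
  shows "f (n - i) = f i"
proof -
  define g where "g j = f (n - j) - f j" for j
  have antisym: "g (n - j) = - g j" if "j \<le> n" for j
    using that by (simp add: g_def)
  have g_add: "g (a + 1) = g a + g 1" if "1 \<le> a" "a + 1 < n" for a
  proof -
    have "g a + g 1 + g (n - (a + 1)) = 0"
      using rel[of a 1 "n - (a + 1)"] that by (simp add: g_def algebra_simps)
    then show ?thesis using antisym[of "a + 1"] that by simp
  qed
  have lin: "g j = scale (of_nat j) (g 1)" if "1 \<le> j" "j < n" for j
    using that
  proof (induction j rule: nat_induct_at_least)
    case base
    show ?case by simp
  next
    case (Suc j)
    then show ?case using g_add[of j] by (simp add: scale_left_distrib add.commute)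
  qed
  have "g 1 + g (n - 1) = 0" using antisym[of 1] i by simp
  moreover have "scale (of_nat (Suc (n - 1))) (g 1) = g 1 + g (n - 1)"
    using lin[of "n - 1"] i by (simp only: of_nat_Suc scale_left_distrib scale_one)
  ultimately have "g 1 = 0" using i by (simp del: of_nat_Suc)
  then show ?thesis using lin[OF i] by (simp add: g_def)
qed

text \<open>
  Subtracting \<open>f 1\<close> loses nothing, since constants satisfy the relations. With \<open>c = d = 1\<close>, the
  symmetry leaves only the values at \<open>1\<close>, \<open>2\<close>, \<open>a\<close>, \<open>a + 1\<close> and \<open>a + 2\<close>, which is the
  recurrence that defines \<open>growth\<close>; the symmetry at the far end \<open>n - 1\<close> is the boundary
  condition that rules out non-zero solutions.
\<close>

lemma symmetric_relations_constant:
  fixes f :: "nat \<Rightarrow> 'a"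
  assumes sym: "\<And>i. 1 \<le> i \<Longrightarrow> i < n \<Longrightarrow> f (n - i) = f i"
    and rel: "\<And>a b c d. a \<ge> 1 \<Longrightarrow> b \<ge> 1 \<Longrightarrow> c \<ge> 1 \<Longrightarrow> d \<ge> 1 \<Longrightarrow> a + b + c + d = n \<Longrightarrow>
      scale 6 (f (n - a) + f (n - b) + f (n - c) + f (n - d)) =
      scale 4 (f (a + b) + f (a + c) + f (a + d) + f (b + c) + f (b + d) + f (c + d))"
    and i: "1 \<le> i" "i < n"
  shows "f i = f 1"
proof (cases "n \<le> 2")
  case True
  then have "i = 1" using i by simp
  then show ?thesis by simp
next
  case False
  define h where "h j = f j - f 1" for j
  have h_sym: "h (n - j) = h j" if "1 \<le> j" "j < n" for j
    using sym[OF that] by (simp add: h_def)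
  have h1: "h 1 = 0" by (simp add: h_def)
  have rec: "h (a + 2) = scale (8/3) (h (a + 1)) - h a + scale (4/3) (h 2)"
    if a: "1 \<le> a" "a + 2 < n" for a
  proof -
    \<comment> \<open>The second exponent, chosen so that \<open>a + b + 1 + 1 = n\<close>;
      then \<open>f b = f (a + 2)\<close> by symmetry.\<close>
    define b where "b = n - (a + 2)"
    have b: "b \<ge> 1" "a + b + 1 + 1 = n" using a by (auto simp: b_def)
    have eqs: "f (n - a) = f a" "f (n - b) = f (a + 2)" "f b = f (a + 2)" "f (n - 1) = f 1"
      "f (a + b) = f 2" "f (b + 1) = f (a + 1)"
      using sym[of a] sym[of b] sym[of 1] sym[of 2] sym[of "a + 1"] a b
      by (auto simp: algebra_simps)
    have "scale 6 (f a + f (a + 2) + f 1 + f 1) =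
        scale 4 (f 2 + f (a + 1) + f (a + 1) + f (a + 1) + f (a + 1) + f 2)"
      using rel[of a b 1 1] a b eqs by (simp add: eqs numeral_2_eq_2)
    then have "scale 6 (h a + h (a + 2)) = scale 8 (h 2 + h (a + 1) + h (a + 1))"
      unfolding h_def scale_numeral_unfold by (simp add: algebra_simps)
    then have "scale (1/6) (scale 6 (h a + h (a + 2))) =
        scale (1/6) (scale 8 (h 2 + h (a + 1) + h (a + 1)))"
      by simp
    then have "h a + h (a + 2) = scale (4/3) (h 2 + scale 2 (h (a + 1)))"
      by (simp add: scale_numeral_unfold(1) add.assoc)
    then show ?thesis by (simp add: scale_right_distrib algebra_simps)
  qed
  have closed: "h (Suc k) = scale (of_rat (growth k)) (h 2)" if "Suc k < n" for k
    using that
  proof (induction k rule: growth.induct)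
    case 1
    then show ?case using h1 by simp
  next
    case 2
    then show ?case by (simp add: numeral_2_eq_2)
  next
    case (3 k)
    then show ?case using rec[of "Suc k"]
      by (simp add: of_rat_add of_rat_diff of_rat_mult of_rat_divide
          scale_left_distrib scale_left_diff_distrib)
  qed
  have "scale (of_rat (growth (n - 2))) (h 2) = 0"
    using closed[of "n - 2"] h_sym[of 1] h1 False by (simp add: Suc_diff_Suc numeral_2_eq_2)
  then have "h 2 = 0" using growth_pos[of "n - 2"] False by simp
  then have "h i = 0" using closed[of "i - 1"] i by simp
  then show ?thesis by (simp add: h_def)
qed

end

section \<open>Twisted powers and their products\<close>

locale multiplicative_hom_algebra = hom_algebra scale mu \<alpha>
  for scale :: "'k::field_char_0 \<Rightarrow> 'a::ab_group_add \<Rightarrow> 'a"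
    and mu :: "'a \<Rightarrow> 'a \<Rightarrow> 'a" and \<alpha> :: "'a \<Rightarrow> 'a" +
  assumes multiplicative: "multiplicative mu \<alpha>"
begin

sublocale vector_space_char_0 scale ..

lemma mu_add_right: "mu x (y + z) = mu x y + mu x z"
  using mu_linear_right by (simp add: Vector_Spaces.linear_iff)

lemma mu_add_left: "mu (x + y) z = mu x z + mu y z"
  using mu_linear_left by (simp add: Vector_Spaces.linear_iff)

lemma alpha_add: "\<alpha> (x + y) = \<alpha> x + \<alpha> y"
  using alpha_linear by (simp add: Vector_Spaces.linear_iff)

lemma alpha_mu: "\<alpha> (mu x y) = mu (\<alpha> x) (\<alpha> y)"
  using multiplicative by (simp add: multiplicative_def)

lemma alpha_pow_mu: "(\<alpha> ^^ m) (mu x y) = mu ((\<alpha> ^^ m) x) ((\<alpha> ^^ m) y)"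
  by (induction m) (simp_all add: alpha_mu)

abbreviation twisted_power :: "'a \<Rightarrow> nat \<Rightarrow> nat \<Rightarrow> 'a" where
  "twisted_power x i s \<equiv> (\<alpha> ^^ s) (hom_power mu \<alpha> x i)"

text \<open>
  The right-hand side of the \<open>n\<close>-th Hom-power identity at \<open>i\<close>, so that the identity says that this
  equals the \<open>n\<close>-th Hom-power.
\<close>

definition split_product :: "'a \<Rightarrow> nat \<Rightarrow> nat \<Rightarrow> 'a" where
  "split_product x n i = mu (twisted_power x i (n - i - 1)) (twisted_power x (n - i) (i - 1))"

text \<open>
  The twists of the two factors have to differ by \<open>j - i\<close>: the Hom-power identity prescribes \<open>j - 1\<close> and \<open>i - 1\<close>, and a common further twist by \<open>t\<close> comes from
  multiplicativity.
\<close>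

lemma twisted_power_mult:
  assumes assoc: "nth_hom_power_associative mu \<alpha> (i + j)"
    and "1 \<le> i" "1 \<le> j" "p = j - 1 + t" "q = i - 1 + t"
  shows "mu (twisted_power x i p) (twisted_power x j q) = twisted_power x (i + j) t"
proof -
  have "hom_power mu \<alpha> x (i + j) = mu (twisted_power x i (j - 1)) (twisted_power x j (i - 1))"
    using assoc assms(2,3) unfolding nth_hom_power_associative_def
    by (auto dest!: spec[of _ x] bspec[of _ _ i])
  then show ?thesis
    using assms(4,5) by (simp add: alpha_pow_mu funpow_add add.commute)
qed

lemma hom_power_eq_split_product:
  assumes "2 \<le> n"
  shows "hom_power mu \<alpha> x n = split_product x n (n - 1)"
proof -
  obtain m where "n = Suc (Suc m)" using assms by (metis add_2_eq_Suc le_Suc_ex)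
  then show ?thesis by (simp add: split_product_def)
qed

text \<open>
  The powers \<open>x\<^sup>a, x\<^sup>b, x\<^sup>c\<close> are inserted into the polarized cubic identity with twists
  \<open>b + c - 2\<close>, \<open>a + c - 2\<close>, \<open>a + b - 2\<close>. Then any two of them multiply to a twisted power, because
  their sum of exponents is below \<open>n\<close>, and multiplying by \<open>\<alpha>\<close> of the third gives a split product of
  \<open>x\<^sup>n\<close>. The six permutations yield the relation
  twice, because exchanging the two factors of an inner product does not change it.
\<close>

lemma split_product_cubic_relation:
  fixes x :: 'a
  assumes cubic: "\<And>x. mu (mu x x) (\<alpha> x) = mu (\<alpha> x) (mu x x)"
    and assoc: "\<And>m. 2 \<le> m \<Longrightarrow> m < n \<Longrightarrow> nth_hom_power_associative mu \<alpha> m"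
    and pos: "1 \<le> a" "1 \<le> b" "1 \<le> c" and sum: "a + b + c = n"
  defines "f \<equiv> split_product x n"
  shows "f (n - a) + f (n - b) + f (n - c) = f a + f b + f c"
proof -
  define T where "T u v w = mu (mu u v) (\<alpha> w) - mu (\<alpha> u) (mu v w)" for u v w
  define X where "X i = twisted_power x i (n - i - 2)" for i
  have polar: "T u v w + T u w v + T v u w + T v w u + T w u v + T w v u = 0" for u v w
    by (rule polarize_trilinear)
      (simp_all add: T_def mu_add_left mu_add_right alpha_add cubic algebra_simps)
  have TX: "T (X a) (X b) (X c) = f (n - c) - f a"
    if "1 \<le> a" "1 \<le> b" "1 \<le> c" "a + b + c = n" for a b c
  proof -
    have ab: "mu (X a) (X b) = twisted_power x (a + b) (c - 1)"
      unfolding X_def by (rule twisted_power_mult) (use that in \<open>auto intro: assoc\<close>)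
    have bc: "mu (X b) (X c) = twisted_power x (b + c) (a - 1)"
      unfolding X_def by (rule twisted_power_mult) (use that in \<open>auto intro: assoc\<close>)
    have \<alpha>X: "\<alpha> (X i) = twisted_power x i (n - i - 1)" if "i + 2 \<le> n" for i
    proof -
      have "n - i - 1 = Suc (n - i - 2)" using that by simp
      then show ?thesis by (simp add: X_def)
    qed
    have "n - c = a + b" "n - a = b + c" "n - (a + b) = c" "n - (a + b) - 1 = c - 1"
      using that by auto
    then show ?thesis
      using that by (simp add: T_def ab bc \<alpha>X f_def split_product_def)
  qed
  have ac: "a + b + c = n" "a + c + b = n" "b + a + c = n" "b + c + a = n" "c + a + b = n"
    "c + b + a = n"
    using sum by simp_all
  have "(f (n - a) + f (n - b) + f (n - c) - (f a + f b + f c)) +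
      (f (n - a) + f (n - b) + f (n - c) - (f a + f b + f c)) =
      T (X a) (X b) (X c) + T (X a) (X c) (X b) + T (X b) (X a) (X c) +
      T (X b) (X c) (X a) + T (X c) (X a) (X b) + T (X c) (X b) (X a)"
    by (simp only: TX pos ac) (simp add: algebra_simps)
  also have "\<dots> = 0" by (rule polar)
  finally have "f (n - a) + f (n - b) + f (n - c) - (f a + f b + f c) = 0"
    by (rule double_eq_0)
  then show ?thesis by simp
qed

text \<open>
  The same idea with four powers, now twisted by \<open>n - i - 3\<close> for the power \<open>x\<^sup>i\<close>. The polarized
  identity has 24 terms on each side: the left products depend only on the last factor, so each
  of four values occurs six times, and the right products depend only on the unordered first pair,
  so each of six values occurs four times.
\<close>

lemma split_product_quartic_relation:
  fixes x :: 'a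
  assumes quartic: "\<And>x. mu (mu (mu x x) (\<alpha> x)) (\<alpha> (\<alpha> x)) = mu (\<alpha> (mu x x)) (\<alpha> (mu x x))"
    and assoc: "\<And>m. 2 \<le> m \<Longrightarrow> m < n \<Longrightarrow> nth_hom_power_associative mu \<alpha> m"
    and pos: "1 \<le> a" "1 \<le> b" "1 \<le> c" "1 \<le> d" and sum: "a + b + c + d = n"
  defines "f \<equiv> split_product x n"
  shows "scale 6 (f (n - a) + f (n - b) + f (n - c) + f (n - d)) =
      scale 4 (f (a + b) + f (a + c) + f (a + d) + f (b + c) + f (b + d) + f (c + d))"
proof -
  define T where
    "T t u v w = mu (mu (mu t u) (\<alpha> v)) (\<alpha> (\<alpha> w)) - mu (\<alpha> (mu t u)) (\<alpha> (mu v w))" for t u v w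
  define X where "X i = twisted_power x i (n - i - 3)" for i
  note polar = polarize_quadrilinear[of T "X a" "X b" "X c" "X d"]
  have TX: "T (X a) (X b) (X c) (X d) = f (n - d) - f (a + b)"
    if "1 \<le> a" "1 \<le> b" "1 \<le> c" "1 \<le> d" "a + b + c + d = n" for a b c d
  proof -
    have \<alpha>X: "\<alpha> (X i) = twisted_power x i (n - i - 2)" if "i + 3 \<le> n" for i
    proof -
      have "n - i - 2 = Suc (n - i - 3)" using that by simp
      then show ?thesis by (simp add: X_def)
    qed
    have \<alpha>\<alpha>X: "\<alpha> (\<alpha> (X i)) = twisted_power x i (n - i - 1)" if "i + 3 \<le> n" for i
    proof -
      have "n - i - 1 = Suc (n - i - 2)" using that by simp
      then show ?thesis using that by (simp add: \<alpha>X)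
    qed
    have ab: "mu (X a) (X b) = twisted_power x (a + b) (c + d - 2)"
      unfolding X_def by (rule twisted_power_mult) (use that in \<open>auto intro: assoc\<close>)
    have cd: "mu (X c) (X d) = twisted_power x (c + d) (a + b - 2)"
      unfolding X_def by (rule twisted_power_mult) (use that in \<open>auto intro: assoc\<close>)
    have abc: "mu (mu (X a) (X b)) (\<alpha> (X c)) = twisted_power x (a + b + c) (d - 1)"
      unfolding ab using that
      by (subst \<alpha>X, simp, intro twisted_power_mult) (auto intro: assoc)
    have \<alpha>ab: "\<alpha> (mu (X a) (X b)) = twisted_power x (a + b) (c + d - 1)"
    proof -
      have "c + d - 1 = Suc (c + d - 2)" using that by simp
      then show ?thesis by (simp add: ab)
    qed
    have \<alpha>cd: "\<alpha> (mu (X c) (X d)) = twisted_power x (c + d) (a + b - 1)"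
    proof -
      have "a + b - 1 = Suc (a + b - 2)" using that by simp
      then show ?thesis by (simp add: cd)
    qed
    have "n - d = a + b + c" "n - (a + b) = c + d" "n - (a + b + c) = d"
      "n - (a + b + c) - 1 = d - 1"
      using that by auto
    then show ?thesis
      using that unfolding T_def \<alpha>ab \<alpha>cd abc
      by (simp add: \<alpha>\<alpha>X f_def split_product_def)
  qed
  have comm: "f (b + a) = f (a + b)" "f (c + a) = f (a + c)" "f (d + a) = f (a + d)"
    "f (c + b) = f (b + c)" "f (d + b) = f (b + d)" "f (d + c) = f (c + d)"
    by (simp_all add: add.commute)
  have ac: "a + b + c + d = n" "a + b + d + c = n" "a + c + b + d = n" "a + c + d + b = n"
    "a + d + b + c = n" "a + d + c + b = n" "b + a + c + d = n" "b + a + d + c = n"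
    "b + c + a + d = n" "b + c + d + a = n" "b + d + a + c = n" "b + d + c + a = n"
    "c + a + b + d = n" "c + a + d + b = n" "c + b + a + d = n" "c + b + d + a = n"
    "c + d + a + b = n" "c + d + b + a = n" "d + a + b + c = n" "d + a + c + b = n"
    "d + b + a + c = n" "d + b + c + a = n" "d + c + a + b = n" "d + c + b + a = n"
    using sum by simp_all
  have diff_0: "u = v" if "w = 0" "w = u - v" for u v w :: 'a
    using that by simp
  show ?thesis
  proof (rule diff_0[OF polar])
    show "T u u u u = 0" for u by (simp add: T_def quartic)
    show "(T (X a) (X b) (X c) (X d) + T (X a) (X c) (X b) (X d) + T (X b) (X a) (X c) (X d) +
        T (X b) (X c) (X a) (X d) + T (X c) (X a) (X b) (X d) + T (X c) (X b) (X a) (X d)) +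
      (T (X a) (X b) (X d) (X c) + T (X a) (X d) (X b) (X c) + T (X b) (X a) (X d) (X c) +
        T (X b) (X d) (X a) (X c) + T (X d) (X a) (X b) (X c) + T (X d) (X b) (X a) (X c)) +
      (T (X a) (X c) (X d) (X b) + T (X a) (X d) (X c) (X b) + T (X c) (X a) (X d) (X b) +
        T (X c) (X d) (X a) (X b) + T (X d) (X a) (X c) (X b) + T (X d) (X c) (X a) (X b)) +
      (T (X b) (X c) (X d) (X a) + T (X b) (X d) (X c) (X a) + T (X c) (X b) (X d) (X a) +
        T (X c) (X d) (X b) (X a) + T (X d) (X b) (X c) (X a) + T (X d) (X c) (X b) (X a)) =
      scale 6 (f (n - a) + f (n - b) + f (n - c) + f (n - d)) -
      scale 4 (f (a + b) + f (a + c) + f (a + d) + f (b + c) + f (b + d) + f (c + d))"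
      unfolding scale_numeral_unfold
      by (simp only: TX pos ac comm) (simp add: algebra_simps)
  qed (simp_all add: T_def mu_add_left mu_add_right alpha_add algebra_simps)
qed

section \<open>Hom-power associativity\<close>

text \<open>
  The induction has no separate base cases: for \<open>n = 2\<close> there is only \<open>f 1\<close>, and the lemmas above
  also cover \<open>n = 3\<close> and \<open>n = 4\<close>, where the relations are multiples of the two given identities.
\<close>

theorem hom_power_associative_if_cubic_quartic:
  assumes cubic: "\<And>x. mu (mu x x) (\<alpha> x) = mu (\<alpha> x) (mu x x)"
    and quartic: "\<And>x. mu (mu (mu x x) (\<alpha> x)) (\<alpha> (\<alpha> x)) = mu (\<alpha> (mu x x)) (\<alpha> (mu x x))"
  shows "hom_power_associative mu \<alpha>"
proof -
  have "nth_hom_power_associative mu \<alpha> n" if "2 \<le> n" for n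
    using that
  proof (induction n rule: less_induct)
    case (less n)
    have assoc: "nth_hom_power_associative mu \<alpha> m" if "2 \<le> m" "m < n" for m
      using less.IH that by simp
    have "hom_power mu \<alpha> x n = split_product x n i" if i: "1 \<le> i" "i < n" for x i
    proof -
      have sym: "split_product x n (n - j) = split_product x n j" if "1 \<le> j" "j < n" for j
        by (rule antisymmetric_part_zero[where f = "split_product x n", OF _ that])
          (rule split_product_cubic_relation[OF cubic assoc])
      have const: "split_product x n j = split_product x n 1" if "1 \<le> j" "j < n" for j
        by (rule symmetric_relations_constant[where f = "split_product x n", OF _ _ that])
          (erule (1) sym, rule split_product_quartic_relation[OF quartic assoc])
      show ?thesis
        using hom_power_eq_split_product[OF less.prems] const[OF i] const[of "n - 1"] less.prems
        by simp
    qed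
    then show ?case
      by (auto simp: nth_hom_power_associative_def split_product_def)
  qed
  then show ?thesis by (simp add: hom_power_associative_def)
qed

end

theorem corollary5p6:
  fixes scale :: "'k::field_char_0 \<Rightarrow> 'a::ab_group_add \<Rightarrow> 'a"
    and mu :: "'a \<Rightarrow> 'a \<Rightarrow> 'a"
    and \<alpha> :: "'a \<Rightarrow> 'a"
  assumes "hom_algebra scale mu \<alpha>"
    and "multiplicative mu \<alpha>"
  shows "(right_hom_alternative mu \<alpha> \<longrightarrow> hom_power_associative mu \<alpha>) \<and>
         (noncommutative_hom_jordan mu \<alpha> \<longrightarrow> hom_power_associative mu \<alpha>)"
proof -
  interpret hom_algebra scale mu \<alpha> by fact
  interpret multiplicative_hom_algebra scale mu \<alpha> by unfold_locales fact
  have main: "hom_power_associative mu \<alpha>"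
    if "\<And>x. hom_associator mu \<alpha> x x x = 0"
      and "\<And>x. hom_associator mu \<alpha> (mu x x) (\<alpha> x) (\<alpha> x) = 0"
    by (rule hom_power_associative_if_cubic_quartic)
      (use that in \<open>simp_all add: hom_associator_def alpha_mu\<close>)
  show ?thesis
    using main
    by (auto simp: right_hom_alternative_def noncommutative_hom_jordan_def hom_flexible_def)
qed

end
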